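(* Let $A_1,\ldots,A_m$ be real symmetric $d\times d$ matrices and let $\{S_{ij}\}_{1\le i\le m,\,1\le j\le N}$ be independent (not necessarily identically distributed) random swaps. Then the polynomial in $t$ $$\mathbb{E}\, \det\left(tI-\sum_{i=1}^m \left(S_{iN}S_{i,N-1}\cdots S_{i1}\right) A_i \left(S_{i1}^TS_{i2}^T\cdots S_{iN}^T\right)\right)$$ is real-rooted.
   Context: A random swap is a matrix-valued random variable which, for some fixed pair of distinct indices $s,t\in\{1,\ldots,d\}$ and some $\alpha\in[0,1]$, equals the $d\times d$ permutation matrix of the transposition of $s$ and $t$ with probability $\alpha$ and equals the identity matrix with probability $1-\alpha$. A polynomial is real-rooted if all its roots are real. *)

theory Defs
  imports "HOL-Probability.Probability" "HOL-Computational_Algebra.Polynomial"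
begin

definition permutation_matrix :: "('n \<Rightarrow> 'n) \<Rightarrow> real ^ 'n ^ 'n" where
  "permutation_matrix \<pi> = (\<chi> i j. if i = \<pi> j then 1 else 0)"

definition (in prob_space) random_swap :: "('a \<Rightarrow> real ^ 'n ^ 'n) \<Rightarrow> bool" where
  "random_swap S \<longleftrightarrow>
     random_variable borel S \<and>
     (\<exists>s t \<alpha>. s \<noteq> t \<and> 0 \<le> \<alpha> \<and> \<alpha> \<le> 1 \<and>
        prob {\<omega> \<in> space M. S \<omega> = permutation_matrix (Transposition.transpose s t)} = \<alpha> \<and>
        prob {\<omega> \<in> space M. S \<omega> = mat 1} = 1 - \<alpha>)"

text \<open>Multiplication in the type class \<open>times\<close> is componentwise on vectors, so
  \<open>prod_list\<close> does not give the matrix product.\<close>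

definition mat_prod_list :: "(real ^ 'n ^ 'n) list \<Rightarrow> real ^ 'n ^ 'n" where
  "mat_prod_list Bs = foldr (**) Bs (mat 1)"

text \<open>Roots are taken in the complex numbers; in particular the zero polynomial is
  not real-rooted.\<close>

definition real_rooted :: "real poly \<Rightarrow> bool" where
  "real_rooted p \<longleftrightarrow> (\<forall>z::complex. poly (map_poly of_real p) z = 0 \<longrightarrow> z \<in> \<real>)"

end

theory Submission
  imports Defs
begin

text \<open>A function \<open>f\<close> from families of symmetric matrices to monic polynomials of degree \<open>d\<close> is called
  rank-one stable if all its values are real-rooted, it is affine along rank-one updates
  \<open>A\<^sub>i + x u u\<^sup>T\<close>, and the next coefficient is minus the total trace. If \<open>q\<close> is the slope of such an
  update at \<open>p = f A\<close>, then \<open>p + x q\<close> is real-rooted for all real \<open>x\<close>, which forces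
  \<open>Im (q / p) > 0\<close> (or \<open>q = 0\<close>) on the upper half plane. A swap is a reflection, so the two matrices
  that it averages differ from a common one by positive rank-one updates; as the condition on
  \<open>Im (q / p)\<close> is convex, averaging over a swap preserves rank-one stability. The
  characteristic polynomial of the sum is rank-one stable, and by independence the expectation is
  an iterated average over swaps.\<close>

subsection \<open>Polynomials on the upper half plane\<close>

definition ceval :: "real poly \<Rightarrow> complex \<Rightarrow> complex" where
  "ceval p z = poly (map_poly of_real p) z"

lemma ceval_add [simp]: "ceval (p + q) z = ceval p z + ceval q z"
proof -
  have "map_poly complex_of_real (p + q) = map_poly of_real p + map_poly of_real q"
    by (intro poly_eqI) (simp add: coeff_map_poly)
  then show ?thesis by (simp add: ceval_def)
qed

lemma ceval_smult [simp]: "ceval (smult c p) z = of_real c * ceval p z"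
proof -
  have "map_poly complex_of_real (smult c p) = smult (of_real c) (map_poly of_real p)"
    by (intro poly_eqI) (simp add: coeff_map_poly)
  then show ?thesis by (simp add: ceval_def)
qed

lemma ceval_0 [simp]: "ceval 0 z = 0"
  by (simp add: ceval_def)

lemma ceval_1 [simp]: "ceval 1 z = 1"
  by (simp add: ceval_def)

lemma ceval_pCons [simp]: "ceval (pCons a p) z = of_real a + z * ceval p z"
  by (simp add: ceval_def map_poly_pCons)

lemma ceval_mult [simp]: "ceval (p * q) z = ceval p z * ceval q z"
  by (induction p) (simp_all add: algebra_simps)

lemma ceval_diff [simp]: "ceval (p - q) z = ceval p z - ceval q z"
  using ceval_add[of "p - q" q z] by (simp add: algebra_simps)

lemma ceval_sum: "ceval (sum f A) z = (\<Sum>x\<in>A. ceval (f x) z)"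
  by (induction A rule: infinite_finite_induct) simp_all

lemma ceval_prod: "ceval (prod f A) z = (\<Prod>x\<in>A. ceval (f x) z)"
  by (induction A rule: infinite_finite_induct) simp_all

text \<open>Non-real roots of a real polynomial come in conjugate pairs, so excluding the open upper
  half plane excludes the lower one too.\<close>

lemma real_rootedI:
  assumes "\<And>z. Im z > 0 \<Longrightarrow> ceval p z \<noteq> 0"
  shows "real_rooted p"
  unfolding real_rooted_def
proof (intro allI impI)
  fix z assume z: "poly (map_poly complex_of_real p) z = 0"
  have "poly (map_poly complex_of_real p) (cnj z) = 0"
    using z poly_cnj_real[of "map_poly complex_of_real p" z] by (simp add: coeff_map_poly)
  with z assms[of z] assms[of "cnj z"] have "Im z = 0"
    by (cases "Im z" "0::real" rule: linorder_cases) (auto simp: ceval_def)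
  then show "z \<in> \<real>" by (simp add: complex_is_Real_iff)
qed

text \<open>Near infinity \<open>q / p\<close> behaves like \<open>c / z\<close>, where
  \<open>c < 0\<close> is the quotient of the leading coefficients. At \<open>z = i y\<close> this
  is \<open>- i c / y\<close>, whose imaginary part is positive.\<close>

lemma Im_quotient_eventually_pos:
  fixes p q :: "real poly"
  assumes "degree p = Suc (degree q)" and "lead_coeff p > 0" and "lead_coeff q < 0"
  shows "\<exists>y>0. Im (ceval q (\<i> * of_real y) / ceval p (\<i> * of_real y)) > 0"
proof -
  let ?P = "map_poly complex_of_real p" and ?Q = "map_poly complex_of_real q"
  define n where "n = degree q"
  have dp: "degree ?P = Suc n" "degree ?Q = n"
    using assms(1) by (simp_all add: degree_map_poly n_def)
  have lp: "lead_coeff ?P = of_real (lead_coeff p)" "lead_coeff ?Q = of_real (lead_coeff q)"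
    by (simp_all add: coeff_map_poly degree_map_poly)
  \<comment> \<open>Away from \<open>0\<close> this is \<open>z q(z) / p(z)\<close>. Dividing each
    polynomial by its top power of \<open>z\<close> makes both limits at infinity leading
    coefficients.\<close>
  define h where "h = (\<lambda>z. (poly ?Q z / z ^ n) / (poly ?P z / z ^ Suc n))"
  have lim: "(h \<longlongrightarrow> of_real (lead_coeff q) / of_real (lead_coeff p)) at_infinity"
  proof -
    have "lead_coeff ?P \<noteq> 0"
      using assms(2) unfolding lp by auto
    from tendsto_divide[OF poly_divide_tendsto_aux[of ?Q] poly_divide_tendsto_aux[of ?P] this]
    show ?thesis unfolding lp unfolding dp h_def .
  qed
  have fl: "filterlim (\<lambda>y. \<i> * complex_of_real y) at_infinity at_top"
    by (rule filterlim_norm_at_top_imp_at_infinity)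
      (simp add: norm_mult filterlim_at_top_imp_at_infinity, real_asymp)
  have "((\<lambda>y. Re (h (\<i> * of_real y))) \<longlongrightarrow> Re (of_real (lead_coeff q) / of_real (lead_coeff p))) at_top"
    by (intro tendsto_intros filterlim_compose[OF lim fl])
  moreover have "Re (of_real (lead_coeff q) / of_real (lead_coeff p)) < 0"
    using assms(2,3) by (simp add: divide_neg_pos flip: of_real_divide)
  ultimately have "\<forall>\<^sub>F y in at_top. Re (h (\<i> * of_real y)) < 0"
    by (rule order_tendstoD)
  then have "\<forall>\<^sub>F y in at_top. (0::real) < y \<and> Re (h (\<i> * of_real y)) < 0"
    using eventually_gt_at_top by (rule eventually_conj[rotated])
  then obtain y :: real where y: "0 < y" "Re (h (\<i> * of_real y)) < 0"
    by (metis (mono_tags, lifting) eventually_happens trivial_limit_at_top_linorder)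
  have "h (\<i> * of_real y) = \<i> * of_real y * (ceval q (\<i> * of_real y) / ceval p (\<i> * of_real y))"
    using y(1) by (simp add: h_def ceval_def)
  with y(2) have "Re (\<i> * of_real y * (ceval q (\<i> * of_real y) / ceval p (\<i> * of_real y))) < 0"
    by (simp only:)
  moreover have "Re (\<i> * of_real y * w) = - (y * Im w)" for w
    by simp
  ultimately have "y * Im (ceval q (\<i> * of_real y) / ceval p (\<i> * of_real y)) > 0"
    by (metis neg_less_0_iff_less)
  with y(1) show ?thesis
    using zero_less_mult_pos by blast
qed

text \<open>If no real combination \<open>p + x q\<close> vanishes on the upper half plane, then \<open>q / p\<close> avoids
  the nonzero reals there, so its imaginary part has a constant sign, which can be read off at
  \<open>\<i> \<infinity>\<close>.\<close>

lemma Im_quotient_pos: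
  fixes p q :: "real poly"
  assumes nz: "\<And>x z. Im z > 0 \<Longrightarrow> ceval (p + smult x q) z \<noteq> 0"
    and "degree p = Suc (degree q)" and "lead_coeff p > 0" and "lead_coeff q < 0"
    and z: "Im z > 0"
  shows "ceval q z = 0 \<or> Im (ceval q z / ceval p z) > 0"
proof (rule ccontr)
  assume neg: "\<not> ?thesis"
  \<comment> \<open>At the zeros of \<open>q\<close> the quotient is real without contradiction, so
    they have to be removed from the half plane.\<close>
  define T where "T = {z. ceval q z = 0}"
  define g where "g = (\<lambda>z. Im (ceval q z / ceval p z))"
  let ?H = "{z. Im z > 0}"
  have p0: "ceval p w \<noteq> 0" if "Im w > 0" for w
    using nz[OF that, of 0] by simp
  have g0: "g w \<noteq> 0" if "w \<in> ?H - T" for w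
  proof
    assume "g w = 0"
    then have "ceval q w / ceval p w \<in> \<real>"
      by (simp add: g_def complex_is_Real_iff)
    then obtain r where r: "ceval q w / ceval p w = of_real r"
      by (auto elim: Reals_cases)
    have w: "Im w > 0" "ceval q w \<noteq> 0" using that by (auto simp: T_def)
    then have "r \<noteq> 0" using r p0[of w] by auto
    \<comment> \<open>A nonzero real value \<open>r\<close> of \<open>q / p\<close> at
      \<open>w\<close> makes the real combination \<open>p - q / r\<close> vanish there.\<close>
    then have "ceval (p + smult (- (1 / r)) q) w = 0"
      using r p0[OF w(1)] by (auto simp: field_simps)
    with nz[OF w(1)] show False by blast
  qed
  have "map_poly complex_of_real q \<noteq> 0"
    using assms(4) by (auto simp: map_poly_eq_0_iff)
  then have "finite T"
    unfolding T_def ceval_def by (rule poly_roots_finite)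
  \<comment> \<open>Removing finitely many points from the half plane keeps it connected, so
    \<open>g\<close>, having no zero there, cannot change sign.\<close>
  then have con: "connected (?H - T)"
    by (intro connected_open_diff_countable open_halfspace_Im_gt countable_finite
        convex_connected convex_halfspace_Im_gt) simp_all
  have "continuous_on (?H - T) g"
    unfolding g_def ceval_def
    by (intro continuous_intros) (auto simp: p0 simp flip: ceval_def)
  then have cg: "connected (g ` (?H - T))"
    using con by (rule connected_continuous_image)
  obtain y where y: "y > 0" "g (\<i> * of_real y) > 0"
    using Im_quotient_eventually_pos[OF assms(2-4)] by (auto simp: g_def)
  then have "\<i> * of_real y \<in> ?H - T" by (auto simp: T_def g_def)
  moreover have "z \<in> ?H - T" "g z < 0"
    using neg z g0[of z] by (auto simp: T_def g_def)
  ultimately have "0 \<in> g ` (?H - T)"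
    using y(2) connected_contains_Icc[OF cg, of "g z" "g (\<i> * of_real y)"] by force
  with g0 show False by fastforce
qed

subsection \<open>Rank-one matrices\<close>

definition outer :: "real ^ 'n \<Rightarrow> real ^ 'n \<Rightarrow> real ^ 'n ^ 'n" where
  "outer u v = (\<chi> i j. u $ i * v $ j)"

lemma matrix_mul_outer: "A ** outer u v = outer (A *v u) v"
  by (vector outer_def matrix_matrix_mult_def matrix_vector_mult_def)
    (simp add: sum_distrib_right mult.assoc)

lemma outer_matrix_mul: "outer u v ** A = outer u (transpose A *v v)"
  by (vector outer_def matrix_matrix_mult_def matrix_vector_mult_def transpose_def)
    (simp add: sum_distrib_left mult_ac)

lemma outer_mul_outer: "outer u v ** outer w x = (v \<bullet> w) *\<^sub>R outer u x"
  by (simp add: vec_eq_iff outer_def matrix_matrix_mult_def inner_vec_def sum_distrib_right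
      sum_distrib_left mult_ac)

lemma transpose_outer [simp]: "transpose (outer u v) = outer v u"
  by (simp add: vec_eq_iff outer_def transpose_def mult.commute)

lemma trace_outer: "trace (outer u v) = u \<bullet> v"
  by (simp add: trace_def outer_def inner_vec_def)

lemma trace_sum: "trace (sum f I) = (\<Sum>i\<in>I. trace (f i :: real ^ 'n ^ 'n))"
  unfolding trace_def sum_component by (rule sum.swap)

lemma transpose_add: "transpose (A + B) = transpose A + transpose (B :: real ^ 'n ^ 'n)"
  by (simp add: vec_eq_iff transpose_def)

lemma transpose_diff: "transpose (A - B) = transpose A - transpose (B :: real ^ 'n ^ 'n)"
  by (simp add: vec_eq_iff transpose_def)

lemma transpose_sum: "transpose (sum f I) = (\<Sum>i\<in>I. transpose (f i :: real ^ 'n ^ 'n))"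
  by (induction I rule: infinite_finite_induct) (simp_all add: transpose_add vec_eq_iff transpose_def)

lemma matrix_scaleR_right: "A ** (c *\<^sub>R B) = c *\<^sub>R (A ** (B :: real ^ 'n ^ 'n))"
  by (simp add: matrix_scalar_ac scalar_matrix_assoc)

lemma matrix_diff_ldistrib: "A ** (B - C) = A ** B - A ** (C :: real ^ 'n ^ 'n)"
  by (simp add: vec_eq_iff matrix_matrix_mult_def sum_subtractf algebra_simps)

lemma matrix_diff_rdistrib: "(A - B) ** C = A ** C - B ** (C :: real ^ 'n ^ 'n)"
  by (simp add: vec_eq_iff matrix_matrix_mult_def sum_subtractf algebra_simps)

lemma matrix_add_rdistrib: "(A + B) ** C = A ** C + B ** (C :: real ^ 'n ^ 'n)"
  by (simp add: vec_eq_iff matrix_matrix_mult_def sum.distrib algebra_simps)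

text \<open>With \<open>w = A u\<close>, expanding the product subtracts
  \<open>u w^T + w u^T - (u . w) u u^T\<close> from \<open>A\<close>. The vector \<open>v\<close> is
  chosen so that this equals \<open>u v^T + v u^T\<close>, and polarization turns that into a
  difference of two squares.\<close>

lemma reflection_conjugate:
  fixes A :: "real ^ 'n ^ 'n" and u :: "real ^ 'n"
  assumes "transpose A = A"
  defines "v \<equiv> A *v u - ((u \<bullet> (A *v u)) / 2) *\<^sub>R u"
  shows "(mat 1 - outer u u) ** A ** transpose (mat 1 - outer u u)
    = A - (1/2) *\<^sub>R outer (u + v) (u + v) + (1/2) *\<^sub>R outer (u - v) (u - v)"
proof -
  let ?w = "A *v u"
  have "(mat 1 - outer u u) ** A = A - outer u ?w"
    by (simp add: matrix_diff_rdistrib outer_matrix_mul assms(1))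
  then have "(mat 1 - outer u u) ** A ** transpose (mat 1 - outer u u)
    = (A - outer u ?w) ** (mat 1 - outer u u)"
    by (simp add: transpose_diff transpose_mat)
  also have "\<dots> = A - outer u ?w - outer ?w u + (u \<bullet> ?w) *\<^sub>R outer u u"
    by (simp add: matrix_diff_ldistrib matrix_diff_rdistrib matrix_mul_outer[of A] outer_mul_outer
        inner_commute)
  also have "\<dots> = A - (1/2) *\<^sub>R outer (u + v) (u + v) + (1/2) *\<^sub>R outer (u - v) (u - v)"
    by (simp add: vec_eq_iff outer_def v_def field_simps)
  finally show ?thesis .
qed

text \<open>An orthogonal change of basis moves \<open>u\<close> onto a coordinate axis. The update
  then touches a single row, and the determinant is affine in that row.\<close>

lemma det_add_outer:
  fixes B :: "real ^ 'n ^ 'n"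
  shows "det (B + x *\<^sub>R outer u u) = det B + x * (det (B + outer u u) - det B)"
proof -
  obtain k :: 'n where True by blast
  have ax: "axis k (norm u) = norm u *\<^sub>R axis k (1::real)"
    by (simp add: vec_eq_iff axis_def)
  obtain h where h: "orthogonal_transformation h" "h u = axis k (norm u)"
    using orthogonal_transformation_exists[of u "norm u *\<^sub>R axis k 1"] unfolding ax
    by (metis abs_norm_cancel mult.right_neutral norm_axis_1 norm_scaleR)
  define Q where "Q = matrix h"
  have Qu: "Q *v u = axis k (norm u)"
    using h unfolding Q_def by (simp add: matrix_works orthogonal_transformation_def)
  have "orthogonal_matrix Q"
    using h(1) unfolding Q_def by (simp add: orthogonal_transformation_matrix)
  then have dQ: "det Q * det Q = 1"
    using det_orthogonal_matrix by force
  define C where "C = Q ** B ** transpose Q"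
  have conj: "det (B + y *\<^sub>R outer u u) = det (C + y *\<^sub>R outer (axis k (norm u)) (axis k (norm u)))" for y
  proof -
    have "Q ** (B + y *\<^sub>R outer u u) ** transpose Q
      = C + y *\<^sub>R outer (axis k (norm u)) (axis k (norm u))"
      by (simp add: C_def matrix_add_ldistrib matrix_add_rdistrib matrix_scaleR_right
          scalar_matrix_assoc[symmetric] matrix_mul_outer outer_matrix_mul Qu)
    moreover have "det (Q ** (B + y *\<^sub>R outer u u) ** transpose Q) = det (B + y *\<^sub>R outer u u)"
      using dQ by (simp add: det_mul det_transpose mult.commute mult.left_commute)
    ultimately show ?thesis by simp
  qed
  have row: "det (C + y *\<^sub>R outer (axis k (norm u)) (axis k (norm u)))
    = det C + y * det (\<chi> i. if i = k then axis k ((norm u)^2) else C $ i)" for y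
  proof -
    have "C + y *\<^sub>R outer (axis k (norm u)) (axis k (norm u))
      = (\<chi> i. if i = k then C $ k + y *s axis k ((norm u)^2) else C $ i)"
      by (simp add: vec_eq_iff outer_def axis_def power2_eq_square)
    then have "det (C + y *\<^sub>R outer (axis k (norm u)) (axis k (norm u)))
      = det (\<chi> i. if i = k then C $ k else C $ i) + y * det (\<chi> i. if i = k then axis k ((norm u)^2) else C $ i)"
      by (simp only: det_row_add det_row_mul)
    moreover have "(\<chi> i. if i = k then C $ k else C $ i) = C"
      by (simp add: vec_eq_iff)
    ultimately show ?thesis by simp
  qed
  \<comment> \<open>The parameters \<open>0\<close> and \<open>1\<close> identify the constant term
    and the slope of the affine function in \<open>row\<close>.\<close>
  show ?thesis
    using conj[of x] conj[of 1] conj[of 0] row[of x] row[of 1] row[of 0] by simp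
qed

subsection \<open>The characteristic polynomial\<close>

text \<open>The determinant is taken over the ring \<open>real poly\<close>, so that degrees and
  coefficients can be read off the Leibniz formula.\<close>

definition charpoly :: "real ^ 'n ^ 'n \<Rightarrow> real poly" where
  "charpoly A = det (\<chi> i j. (if i = j then [:0, 1:] else 0) - [:A $ i $ j:])"

lemma of_int_sign_poly: "of_int (sign \<pi>) = ([:of_int (sign \<pi>):] :: real poly)"
  by (simp add: sign_def one_pCons)

lemma poly_charpoly: "poly (charpoly A) t = det (mat t - A)"
  unfolding charpoly_def det_def of_int_sign_poly poly_sum
  by (intro sum.cong refl) (simp add: poly_prod mat_def if_distrib if_distribR cong: if_cong)

lemma ceval_charpoly: "ceval (charpoly A) z = det (mat z - (\<chi> i j. of_real (A $ i $ j)))"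
  unfolding charpoly_def det_def of_int_sign_poly ceval_sum
  by (intro sum.cong refl)
    (simp add: ceval_prod mat_def if_distrib[of "\<lambda>p. ceval p z"] if_distribR cong: if_cong)

text \<open>A root \<open>z\<close> is an eigenvalue. For an eigenvector \<open>x\<close>, the
  number \<open>x^* A x\<close> is real because \<open>A\<close> is symmetric, and it equals
  \<open>z |x|^2\<close>; this is impossible for \<open>x\<close> nonzero and
  \<open>Im z > 0\<close>.\<close>

lemma charpoly_nonzero:
  fixes A :: "real ^ 'n ^ 'n"
  assumes sym: "transpose A = A" and z: "Im z > 0"
  shows "ceval (charpoly A) z \<noteq> 0"
proof
  define B :: "complex ^ 'n ^ 'n" where "B = (\<chi> i j. of_real (A $ i $ j))"
  assume "ceval (charpoly A) z = 0"
  then have "\<not> invertible (mat z - B)"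
    by (simp add: ceval_charpoly invertible_det_nz B_def)
  then obtain x where x: "(mat z - B) *v x = 0" "x \<noteq> 0"
    unfolding invertible_left_inverse matrix_left_invertible_ker by blast
  have Bx: "(\<Sum>j\<in>UNIV. of_real (A $ i $ j) * x $ j) = z * x $ i" for i
  proof -
    have "((mat z - B) *v x) $ i = z * x $ i - (\<Sum>j\<in>UNIV. of_real (A $ i $ j) * x $ j)"
    proof -
      have "(mat z - B) $ i $ j * x $ j = (if i = j then z * x $ j else 0) - of_real (A $ i $ j) * x $ j" for j
        by (simp add: mat_def B_def algebra_simps)
      then show ?thesis by (simp add: matrix_vector_mult_def sum_subtractf)
    qed
    with x(1) show ?thesis by simp
  qed
  define s where "s = (\<Sum>i\<in>UNIV. \<Sum>j\<in>UNIV. cnj (x $ i) * (of_real (A $ i $ j) * x $ j))"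
  have "A $ i $ j = A $ j $ i" for i j
    using sym by (metis transpose_def vec_lambda_beta)
  then have "cnj s = (\<Sum>i\<in>UNIV. \<Sum>j\<in>UNIV. cnj (x $ j) * (of_real (A $ j $ i) * x $ i))"
    by (simp add: s_def mult_ac)
  also have "\<dots> = s"
    unfolding s_def by (rule sum.swap)
  finally have "Im s = 0"
    by (metis complex_is_Real_iff Reals_cnj_iff)
  moreover have "s = (\<Sum>i\<in>UNIV. cnj (x $ i) * (z * x $ i))"
    unfolding s_def by (simp add: Bx flip: sum_distrib_left)
  then have "s = z * of_real (\<Sum>i\<in>UNIV. (cmod (x $ i))\<^sup>2)"
    by (simp add: sum_distrib_left complex_norm_square mult_ac del: of_real_power)
  ultimately have "(\<Sum>i\<in>UNIV. (cmod (x $ i))\<^sup>2) = 0"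
    using z by simp
  then have "x = 0"
    by (simp add: sum_nonneg_eq_0_iff vec_eq_iff)
  with x(2) show False by simp
qed

text \<open>Pointwise in \<open>t\<close> this is \<open>det_add_outer\<close> for
  \<open>mat t - A\<close>, with the sign of the update reversed.\<close>

lemma charpoly_add_outer:
  "charpoly (A + x *\<^sub>R outer u u) = charpoly A + smult x (charpoly (A + outer u u) - charpoly A)"
proof (rule poly_ext)
  fix t
  let ?B = "mat t - A"
  have *: "det (mat t - (A + y *\<^sub>R outer u u)) = det ?B - y * (det (?B + outer u u) - det ?B)" for y
    using det_add_outer[of ?B "- y" u] by (simp add: diff_diff_eq)
  show "poly (charpoly (A + x *\<^sub>R outer u u)) t
      = poly (charpoly A + smult x (charpoly (A + outer u u) - charpoly A)) t"
    using *[of x] *[of 1] by (simp add: poly_charpoly right_diff_distrib)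
qed

section \<open>The top coefficients of the characteristic polynomial\<close>

lemma coeff_prod_linear:
  fixes a :: "'i \<Rightarrow> real"
  assumes "finite S"
  shows "degree (\<Prod>i\<in>S. [:- a i, 1:]) = card S \<and> coeff (\<Prod>i\<in>S. [:- a i, 1:]) (card S) = 1 \<and>
    (S \<noteq> {} \<longrightarrow> coeff (\<Prod>i\<in>S. [:- a i, 1:]) (card S - 1) = - (\<Sum>i\<in>S. a i))"
  using assms
proof (induction S rule: finite_induct)
  case empty
  show ?case by simp
next
  case (insert k S)
  let ?p = "\<Prod>i\<in>S. [:- a i, 1:]"
  have "?p \<noteq> 0" using insert(1) by simp
  then have "degree ([:- a k, 1:] * ?p) = Suc (card S)"
    using insert by (subst degree_mult_eq) simp_all
  moreover have "coeff ([:- a k, 1:] * ?p) (Suc (card S)) = 1"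
    using insert by (simp add: coeff_eq_0)
  moreover have "coeff ([:- a k, 1:] * ?p) (card S) = - (a k + (\<Sum>i\<in>S. a i))"
  proof (cases "card S")
    case 0
    then have "S = {}" using insert(1) by simp
    then show ?thesis by simp
  next
    case (Suc n)
    then have "S \<noteq> {}" by auto
    then show ?thesis using insert Suc by simp
  qed
  ultimately show ?case
    using insert by simp
qed

text \<open>A permutation that moves \<open>a\<close> also moves its image of \<open>a\<close>, so
  at least two points are not fixed.\<close>

lemma nonid_fixpoints_card:
  fixes \<pi> :: "'n::finite \<Rightarrow> 'n"
  assumes "\<pi> permutes UNIV" "\<pi> \<noteq> id"
  shows "card {i. \<pi> i = i} + 2 \<le> CARD('n)"
proof -
  obtain a where a: "\<pi> a \<noteq> a" using assms(2) by (auto simp: fun_eq_iff)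
  then have "\<pi> (\<pi> a) \<noteq> \<pi> a"
    using assms(1) by (metis permutes_inj inj_eq)
  then have "card {i. \<pi> i = i} \<le> card (UNIV - {a, \<pi> a})"
    using a by (intro card_mono) auto
  also have "\<dots> = CARD('n) - 2"
    using a by (subst card_Diff_subset) auto
  moreover have "2 \<le> CARD('n)"
    using a card_mono[of UNIV "{a, \<pi> a}"] by simp
  ultimately show ?thesis by linarith
qed

text \<open>In the Leibniz formula only diagonal entries contain the variable. A permutation other
  than the identity therefore contributes degree at most \<open>d - 2\<close>, and the top
  coefficients are those of the product of the diagonal entries.\<close>

lemma charpoly_coeffs:
  fixes A :: "real ^ 'n ^ 'n"
  assumes k: "k \<ge> CARD('n) - 1"
  shows "coeff (charpoly A) k = (if k = CARD('n) then 1 else if k = CARD('n) - 1 then - trace A else 0)"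
proof -
  let ?B = "\<chi> i j. (if i = j then [:0, 1:] else 0) - [:A $ i $ j:]"
  let ?t = "\<lambda>\<pi>. of_int (sign \<pi>) * (\<Prod>i\<in>UNIV. ?B $ i $ \<pi> i)"
  have zero: "coeff (?t \<pi>) k = 0" if \<pi>: "\<pi> permutes UNIV" "\<pi> \<noteq> id" for \<pi> :: "'n \<Rightarrow> 'n"
  proof -
    have "degree (?B $ i $ \<pi> i) \<le> (if \<pi> i = i then 1 else 0)" for i
      by simp
    then have "(\<Sum>i\<in>UNIV. degree (?B $ i $ \<pi> i)) \<le> (\<Sum>i\<in>UNIV. if \<pi> i = i then 1 else 0)"
      by (rule sum_mono)
    also have "\<dots> = card {i. \<pi> i = i}"
      by (simp add: sum.If_cases)
    finally have "degree (\<Prod>i\<in>UNIV. ?B $ i $ \<pi> i) \<le> card {i. \<pi> i = i}"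
      using degree_prod_sum_le[of UNIV "\<lambda>i. ?B $ i $ \<pi> i"] by (simp add: o_def)
    also have "\<dots> < k"
      using nonid_fixpoints_card[OF \<pi>] k by linarith
    finally show ?thesis
      by (simp add: of_int_sign_poly coeff_eq_0)
  qed
  have "coeff (charpoly A) k = (\<Sum>\<pi> | \<pi> permutes UNIV. coeff (?t \<pi>) k)"
    unfolding charpoly_def det_def by (simp add: coeff_sum)
  also have "\<dots> = (\<Sum>\<pi>\<in>{id}. coeff (?t \<pi>) k)"
    by (rule sum.mono_neutral_right) (use zero in blast | simp add: permutes_id finite_permutations)+
  also have "\<dots> = coeff (\<Prod>i\<in>UNIV. [:- (A $ i $ i), 1:]) k"
    by (simp add: sign_id)
  finally show ?thesis
    using coeff_prod_linear[of "UNIV :: 'n set" "\<lambda>i. A $ i $ i"] k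
    by (auto simp: trace_def coeff_eq_0)
qed

subsection \<open>Rank-one stability\<close>

definition symmetric_on :: "'i set \<Rightarrow> ('i \<Rightarrow> real ^ 'n ^ 'n) \<Rightarrow> bool" where
  "symmetric_on I A \<longleftrightarrow> (\<forall>i\<in>I. transpose (A i) = A i)"

text \<open>The slope is expressed by the values at \<open>x = 0\<close> and \<open>x = 1\<close>,
  which avoids a separate slope function. The coefficient clause fixes the degree, the leading
  coefficient and the trace term together; it is what determines the sign of the leading coefficient
  of a slope.\<close>

definition rank_one_stable :: "'i set \<Rightarrow> (('i \<Rightarrow> real ^ 'n ^ 'n) \<Rightarrow> real poly) \<Rightarrow> bool" where
  "rank_one_stable I f \<longleftrightarrow> (\<forall>A. symmetric_on I A \<longrightarrow>
     (\<forall>z. Im z > 0 \<longrightarrow> ceval (f A) z \<noteq> 0) \<and>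
     (\<forall>i\<in>I. \<forall>u x. f (A(i := A i + x *\<^sub>R outer u u)) =
        f A + smult x (f (A(i := A i + outer u u)) - f A)) \<and>
     (\<forall>k\<ge>CARD('n) - 1. coeff (f A) k =
        (if k = CARD('n) then 1 else if k = CARD('n) - 1 then - (\<Sum>i\<in>I. trace (A i)) else 0)))"

lemma rank_one_stable_nonzero:
  "rank_one_stable I f \<Longrightarrow> symmetric_on I A \<Longrightarrow> Im z > 0 \<Longrightarrow> ceval (f A) z \<noteq> 0"
  by (simp add: rank_one_stable_def)

lemma rank_one_stable_update:
  "rank_one_stable I f \<Longrightarrow> symmetric_on I A \<Longrightarrow> i \<in> I \<Longrightarrow>
    f (A(i := A i + x *\<^sub>R outer u u)) = f A + smult x (f (A(i := A i + outer u u)) - f A)"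
  by (simp add: rank_one_stable_def)

lemma rank_one_stable_coeff:
  fixes A :: "'i \<Rightarrow> real ^ 'n ^ 'n"
  shows "rank_one_stable I f \<Longrightarrow> symmetric_on I A \<Longrightarrow> k \<ge> CARD('n) - 1 \<Longrightarrow> coeff (f A) k =
    (if k = CARD('n) then 1 else if k = CARD('n) - 1 then - (\<Sum>i\<in>I. trace (A i)) else 0)"
  by (simp add: rank_one_stable_def)

lemma symmetric_on_update:
  "symmetric_on I A \<Longrightarrow> transpose B = B \<Longrightarrow> symmetric_on I (A(i := B))"
  by (simp add: symmetric_on_def)

lemma symmetric_on_conjugate:
  "symmetric_on I A \<Longrightarrow> symmetric_on I (A(i := P ** A i ** transpose P))" if "i \<in> I"
  using that by (intro symmetric_on_update)
    (simp_all add: symmetric_on_def matrix_transpose_mul matrix_mul_assoc)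

lemma symmetric_on_add_outer:
  "symmetric_on I A \<Longrightarrow> symmetric_on I (A(i := A i + x *\<^sub>R outer u u))" if "i \<in> I"
  using that by (intro symmetric_on_update)
    (simp_all add: symmetric_on_def transpose_add transpose_scalar)

lemma degree_eqI:
  assumes "coeff p n \<noteq> 0" "\<And>k. k > n \<Longrightarrow> coeff p k = 0"
  shows "degree p = n"
  using assms by (intro antisym le_degree degree_le) auto

text \<open>The update raises the total trace by \<open>u . u\<close>, so for nonzero
  \<open>u\<close> the slope \<open>q\<close> has degree \<open>d - 1\<close> and leading
  coefficient \<open>- (u . u) < 0\<close>. Thus \<open>Im_quotient_pos\<close> applies to
  \<open>f A\<close> and \<open>q\<close>; for \<open>u = 0\<close> the slope is
  \<open>0\<close>.\<close>

lemma rank_one_stable_Im_quotient: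
  fixes A :: "'i \<Rightarrow> real ^ 'n ^ 'n" and u :: "real ^ 'n"
  assumes st: "rank_one_stable I f" and "finite I" and sym: "symmetric_on I A" and i: "i \<in> I"
    and z: "Im z > 0"
  defines "q \<equiv> f (A(i := A i + outer u u)) - f A"
  shows "ceval q z = 0 \<or> Im (ceval q z / ceval (f A) z) > 0"
proof (cases "u = 0")
  case True
  then have "outer u u = 0" by (simp add: outer_def vec_eq_iff)
  then show ?thesis by (simp add: q_def)
next
  case False
  have sym': "symmetric_on I (A(i := A i + outer u u))"
    using symmetric_on_add_outer[OF i sym, of 1 u] by simp
  have "(\<Sum>j\<in>I. trace ((A(i := A i + outer u u)) j))
      = (\<Sum>j\<in>I. trace (A j) + (if j = i then u \<bullet> u else 0))"
    by (intro sum.cong) (simp_all add: trace_add trace_outer)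
  also have "\<dots> = (\<Sum>j\<in>I. trace (A j)) + u \<bullet> u"
    using \<open>finite I\<close> i by (simp add: sum.distrib)
  finally have tr: "(\<Sum>j\<in>I. trace ((A(i := A i + outer u u)) j)) = (\<Sum>j\<in>I. trace (A j)) + u \<bullet> u" .
  \<comment> \<open>Subtraction is truncated; the two coefficient positions differ because the index
    type is nonempty.\<close>
  have "CARD('n) \<noteq> CARD('n) - 1"
    using zero_less_card_finite[where 'a = 'n] by linarith
  then have cq: "coeff q k = (if k = CARD('n) - 1 then - (u \<bullet> u) else 0)" if "k \<ge> CARD('n) - 1" for k
    using rank_one_stable_coeff[OF st sym that] rank_one_stable_coeff[OF st sym' that] tr
    by (auto simp: q_def)
  have dq: "degree q = CARD('n) - 1"
    using False by (intro degree_eqI) (simp_all add: cq)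
  have dp: "degree (f A) = CARD('n)"
    by (intro degree_eqI) (simp_all add: rank_one_stable_coeff[OF st sym])
  show ?thesis
  proof (rule Im_quotient_pos[OF _ _ _ _ z])
    \<comment> \<open>By affinity this polynomial is the value of \<open>f\<close> at the family
      updated by \<open>x u u^T\<close>, which is still symmetric for every real
      \<open>x\<close>.\<close>
    show "ceval (f A + smult x q) w \<noteq> 0" if "Im w > 0" for x w
      using rank_one_stable_nonzero[OF st symmetric_on_add_outer[OF i sym] that]
      by (simp only: rank_one_stable_update[OF st sym i] q_def not_False_eq_True)
    show "degree (f A) = Suc (degree q)"
      by (simp add: dp dq)
    show "lead_coeff (f A) > 0"
      by (simp add: dp rank_one_stable_coeff[OF st sym])
    show "lead_coeff q < 0"
      using False by (simp add: dq cq)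
  qed
qed

text \<open>After division by \<open>p\<close>, the imaginary part of the sum consists of two
  nonnegative terms. If the sum vanished, both terms would vanish, which would leave
  \<open>1 = 0\<close>.\<close>

lemma Im_pos_add_nonzero:
  fixes p a b :: complex
  assumes "p \<noteq> 0" "a = 0 \<or> Im (a / p) > 0" "b = 0 \<or> Im (b / p) > 0" "x \<ge> 0" "y \<ge> 0"
  shows "p + of_real x * a + of_real y * b \<noteq> 0"
proof
  assume "p + of_real x * a + of_real y * b = 0"
  then have "(p + of_real x * a + of_real y * b) / p = 0"
    by simp
  then have eq: "1 + of_real x * (a / p) + of_real y * (b / p) = 0"
    using assms(1) by (simp add: add_divide_distrib)
  have nonneg: "0 \<le> x * Im (a / p)" "0 \<le> y * Im (b / p)"
    using assms(2-5) by auto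
  moreover have "Im (1 + of_real x * s + of_real y * t) = x * Im s + y * Im t" for s t
    by simp
  then have "x * Im (a / p) + y * Im (b / p) = 0"
    using eq by (metis zero_complex.sel(2))
  ultimately have "x * Im (a / p) = 0" "y * Im (b / p) = 0"
    by linarith+
  then have "of_real x * (a / p) = 0" "of_real y * (b / p) = 0"
    using assms(2,3) by auto
  with eq have "1 + 0 + 0 = (0 :: complex)" by (simp only:)
  then show False by simp
qed

text \<open>Real-rootedness uses one base family \<open>C\<close> from which both averaged families
  arise by positive rank-one updates. Affinity survives since conjugation by \<open>P\<close> sends
  \<open>u u^T\<close> to \<open>(P u)(P u)^T\<close>, and the coefficients survive since it
  preserves the trace.\<close>

lemma rank_one_stable_average:
  fixes f :: "('i \<Rightarrow> real ^ 'n ^ 'n) \<Rightarrow> real poly" and u :: "real ^ 'n"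
  assumes st: "rank_one_stable I f" and "finite I" and i: "i \<in> I"
    and P: "P = mat 1 - outer u u" "orthogonal_matrix P" and \<alpha>: "0 \<le> \<alpha>" "\<alpha> \<le> 1"
  shows "rank_one_stable I (\<lambda>A. smult \<alpha> (f (A(i := P ** A i ** transpose P))) + smult (1 - \<alpha>) (f A))"
  unfolding rank_one_stable_def
proof (intro allI impI conjI ballI)
  fix A :: "'i \<Rightarrow> real ^ 'n ^ 'n" and z :: complex
  assume sym: "symmetric_on I A" and z: "Im z > 0"
  define v where "v = A i *v u - ((u \<bullet> (A i *v u)) / 2) *\<^sub>R u"
  \<comment> \<open>The common base: by \<open>reflection_conjugate\<close>, adding half of the
    square of \<open>u + v\<close> gives back \<open>A\<close>, and adding half of the square of
    \<open>u - v\<close> gives the conjugated family.\<close>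
  define C where "C = A(i := A i + (- 1/2) *\<^sub>R outer (u + v) (u + v))"
  define qa where "qa = f (C(i := C i + outer (u - v) (u - v))) - f C"
  define qb where "qb = f (C(i := C i + outer (u + v) (u + v))) - f C"
  have symC: "symmetric_on I C"
    unfolding C_def by (rule symmetric_on_add_outer[OF i sym])
  have "transpose (A i) = A i"
    using sym i by (simp add: symmetric_on_def)
  then have "A(i := P ** A i ** transpose P) = C(i := C i + (1/2) *\<^sub>R outer (u - v) (u - v))"
    unfolding P(1) v_def C_def by (subst reflection_conjugate) simp_all
  then have fa: "f (A(i := P ** A i ** transpose P)) = f C + smult (1/2) qa"
    unfolding qa_def by (simp only: rank_one_stable_update[OF st symC i])
  have "A = C(i := C i + (1/2) *\<^sub>R outer (u + v) (u + v))"
    by (simp add: C_def)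
  then have fb: "f A = f C + smult (1/2) qb"
    unfolding qb_def by (metis rank_one_stable_update[OF st symC i])
  \<comment> \<open>The average is \<open>f C\<close> plus a combination of the two slopes at
    \<open>C\<close>, with nonnegative weights.\<close>
  have "ceval (f C) z + of_real (\<alpha> / 2) * ceval qa z + of_real ((1 - \<alpha>) / 2) * ceval qb z \<noteq> 0"
    unfolding qa_def qb_def using \<alpha>
    by (intro Im_pos_add_nonzero rank_one_stable_Im_quotient[OF st \<open>finite I\<close> symC i z]
        rank_one_stable_nonzero[OF st symC z]) auto
  then show "ceval (smult \<alpha> (f (A(i := P ** A i ** transpose P))) + smult (1 - \<alpha>) (f A)) z \<noteq> 0"
    unfolding fa fb by (simp add: field_simps)
next
  fix A :: "'i \<Rightarrow> real ^ 'n ^ 'n" and j u x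
  assume sym: "symmetric_on I A" and j: "j \<in> I"
  define B where "B = A(i := P ** A i ** transpose P)"
  have symB: "symmetric_on I B"
    unfolding B_def by (rule symmetric_on_conjugate[OF i sym])
  \<comment> \<open>The direction of the update after conjugation: only the component
    \<open>i\<close> is conjugated, so \<open>u\<close> changes only if
    \<open>j = i\<close>.\<close>
  define w where "w = (if j = i then P *v u else u)"
  have upd: "(A(j := A j + y *\<^sub>R outer u u))(i := P ** (A(j := A j + y *\<^sub>R outer u u)) i ** transpose P)
      = B(j := B j + y *\<^sub>R outer w w)" for y
    by (auto simp: B_def w_def fun_eq_iff matrix_add_ldistrib matrix_add_rdistrib
        matrix_scaleR_right scalar_matrix_assoc[symmetric] matrix_mul_outer outer_matrix_mul)
  note upd1 = upd[of 1, unfolded scaleR_one]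
  show "smult \<alpha> (f ((A(j := A j + x *\<^sub>R outer u u))(i := P ** (A(j := A j + x *\<^sub>R outer u u)) i ** transpose P))) +
      smult (1 - \<alpha>) (f (A(j := A j + x *\<^sub>R outer u u))) =
    smult \<alpha> (f (A(i := P ** A i ** transpose P))) + smult (1 - \<alpha>) (f A) +
    smult x (smult \<alpha> (f ((A(j := A j + outer u u))(i := P ** (A(j := A j + outer u u)) i ** transpose P))) +
      smult (1 - \<alpha>) (f (A(j := A j + outer u u))) -
      (smult \<alpha> (f (A(i := P ** A i ** transpose P))) + smult (1 - \<alpha>) (f A)))"
    unfolding upd upd1 rank_one_stable_update[OF st symB j, of x] rank_one_stable_update[OF st sym j, of x]
    unfolding B_def[symmetric]
    by (rule poly_eqI) (simp add: algebra_simps)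
next
  fix A :: "'i \<Rightarrow> real ^ 'n ^ 'n" and k
  assume sym: "symmetric_on I A" and k: "CARD('n) - 1 \<le> k"
  have symB: "symmetric_on I (A(i := P ** A i ** transpose P))"
    by (rule symmetric_on_conjugate[OF i sym])
  have "trace (P ** A i ** transpose P) = trace (transpose P ** P ** A i)"
    by (metis matrix_mul_assoc trace_mul_sym)
  then have "trace (P ** A i ** transpose P) = trace (A i)"
    using P(2) by (simp add: orthogonal_matrix)
  then have "(\<Sum>j\<in>I. trace ((A(i := P ** A i ** transpose P)) j)) = (\<Sum>j\<in>I. trace (A j))"
    by (intro sum.cong) simp_all
  then show "coeff (smult \<alpha> (f (A(i := P ** A i ** transpose P))) + smult (1 - \<alpha>) (f A)) k =
      (if k = CARD('n) then 1 else if k = CARD('n) - 1 then - (\<Sum>i\<in>I. trace (A i)) else 0)"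
    using rank_one_stable_coeff[OF st sym k] rank_one_stable_coeff[OF st symB k]
    by (simp add: algebra_simps)
qed

text \<open>The base case of the iteration: a rank-one update of one summand is the same update of
  the sum.\<close>

lemma rank_one_stable_charpoly:
  assumes "finite I"
  shows "rank_one_stable I (\<lambda>A :: 'i \<Rightarrow> real ^ 'n ^ 'n. charpoly (\<Sum>i\<in>I. A i))"
  unfolding rank_one_stable_def
proof (intro allI impI conjI ballI)
  fix A :: "'i \<Rightarrow> real ^ 'n ^ 'n" and z :: complex
  assume "symmetric_on I A" and "Im z > 0"
  then show "ceval (charpoly (\<Sum>i\<in>I. A i)) z \<noteq> 0"
    by (intro charpoly_nonzero) (simp_all add: transpose_sum symmetric_on_def)
next
  fix A :: "'i \<Rightarrow> real ^ 'n ^ 'n" and i u x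
  assume i: "i \<in> I"
  have "(\<Sum>j\<in>I. (A(i := A i + B)) j) = (\<Sum>j\<in>I. A j) + B" for B
  proof -
    have "(\<Sum>j\<in>I. (A(i := A i + B)) j) = (\<Sum>j\<in>I. A j + (if j = i then B else 0))"
      by (intro sum.cong) simp_all
    then show ?thesis using assms i by (simp add: sum.distrib)
  qed
  then show "charpoly (\<Sum>j\<in>I. (A(i := A i + x *\<^sub>R outer u u)) j) = charpoly (\<Sum>j\<in>I. A j) +
      smult x (charpoly (\<Sum>j\<in>I. (A(i := A i + outer u u)) j) - charpoly (\<Sum>j\<in>I. A j))"
    by (simp only: charpoly_add_outer[of _ x])
next
  fix A :: "'i \<Rightarrow> real ^ 'n ^ 'n" and k
  assume "CARD('n) - 1 \<le> k"
  then show "coeff (charpoly (\<Sum>i\<in>I. A i)) k =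
      (if k = CARD('n) then 1 else if k = CARD('n) - 1 then - (\<Sum>i\<in>I. trace (A i)) else 0)"
    by (simp only: charpoly_coeffs trace_sum)
qed

subsection \<open>Iterated averages and expectation\<close>

text \<open>Here \<open>u . u = 2\<close>, so \<open>mat 1 - outer u u\<close> is the reflection
  that exchanges the two basis vectors. That it differs from the identity later makes the two
  outcomes of a swap disjoint events.\<close>

lemma permutation_matrix_transpose:
  fixes s t :: "'n::finite"
  assumes "s \<noteq> t"
  defines "u \<equiv> axis s 1 - axis t 1 :: real ^ 'n"
  shows "permutation_matrix (Transposition.transpose s t) = mat 1 - outer u u"
    and "orthogonal_matrix (permutation_matrix (Transposition.transpose s t))"
    and "permutation_matrix (Transposition.transpose s t) \<noteq> mat 1"
proof -
  show eq: "permutation_matrix (Transposition.transpose s t) = mat 1 - outer u u"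
    using assms(1) by (auto simp: vec_eq_iff permutation_matrix_def mat_def outer_def u_def axis_def
        Transposition.transpose_def)
  have "u \<bullet> u = 2"
    using assms(1) by (simp add: u_def inner_diff_left inner_diff_right inner_axis_axis)
  then have "(mat 1 - outer u u) ** (mat 1 - outer u u) = mat 1"
    by (simp add: matrix_diff_ldistrib matrix_diff_rdistrib outer_mul_outer vec_eq_iff)
  then show "orthogonal_matrix (permutation_matrix (Transposition.transpose s t))"
    unfolding eq by (simp add: orthogonal_matrix transpose_diff)
  have "permutation_matrix (Transposition.transpose s t) $ s $ s \<noteq> (mat 1 :: real ^ 'n ^ 'n) $ s $ s"
    using assms(1) by (simp add: permutation_matrix_def mat_def)
  then show "permutation_matrix (Transposition.transpose s t) \<noteq> mat 1"
    by metis
qed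

text \<open>The head of the list acts first, hence ends up innermost, next to
  \<open>A i\<close>.\<close>

primrec conjugations ::
  "('i \<times> 'j) list \<Rightarrow> ('i \<times> 'j \<Rightarrow> real ^ 'n ^ 'n) \<Rightarrow> ('i \<Rightarrow> real ^ 'n ^ 'n) \<Rightarrow> 'i \<Rightarrow> real ^ 'n ^ 'n" where
  "conjugations [] X A = A"
| "conjugations (k # ks) X A =
    conjugations ks X (A(fst k := X k ** A (fst k) ** transpose (X k)))"

text \<open>The expected value of \<open>f\<close> after independent random conjugations, computed
  without probability. The recursion has the shape of \<open>rank_one_stable_average\<close>,
  applied to the average over the tail.\<close>

primrec averages ::
  "('i \<times> 'j) list \<Rightarrow> ('i \<times> 'j \<Rightarrow> real) \<Rightarrow> ('i \<times> 'j \<Rightarrow> real ^ 'n ^ 'n) \<Rightarrow>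
    (('i \<Rightarrow> real ^ 'n ^ 'n) \<Rightarrow> real poly) \<Rightarrow> ('i \<Rightarrow> real ^ 'n ^ 'n) \<Rightarrow> real poly" where
  "averages [] \<alpha> P f A = f A"
| "averages (k # ks) \<alpha> P f A =
    smult (\<alpha> k) (averages ks \<alpha> P f (A(fst k := P k ** A (fst k) ** transpose (P k)))) +
    smult (1 - \<alpha> k) (averages ks \<alpha> P f A)"

lemma conjugations_cong:
  "(\<And>k. k \<in> set ks \<Longrightarrow> X k = Y k) \<Longrightarrow> conjugations ks X A = conjugations ks Y A"
  by (induction ks arbitrary: A) simp_all

lemma mat_prod_list_append: "mat_prod_list (Bs @ Cs) = mat_prod_list Bs ** mat_prod_list Cs"
  by (induction Bs) (simp_all add: mat_prod_list_def matrix_mul_assoc)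

lemma mat_prod_list_simps [simp]:
  "mat_prod_list [] = mat 1" "mat_prod_list (B # Bs) = B ** mat_prod_list Bs"
  by (simp_all add: mat_prod_list_def)

text \<open>Only pairs with first component \<open>i\<close> change \<open>A i\<close>. Later
  factors multiply from outside, which reverses the order on the left.\<close>

lemma conjugations_eq:
  "conjugations ks X A i =
    mat_prod_list (map X (rev (filter (\<lambda>k. fst k = i) ks))) ** A i **
    mat_prod_list (map (\<lambda>k. transpose (X k)) (filter (\<lambda>k. fst k = i) ks))"
  by (induction ks arbitrary: A) (simp_all add: mat_prod_list_append matrix_mul_assoc)

lemma filter_fst_product:
  "distinct xs \<Longrightarrow> filter (\<lambda>k. fst k = i) (List.product xs ys) = (if i \<in> set xs then map (Pair i) ys else [])"
  by (induction xs) (auto simp: filter_map o_def intro!: filter_False)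

lemma rank_one_stable_averages:
  fixes f :: "('i \<Rightarrow> real ^ 'n ^ 'n) \<Rightarrow> real poly"
  assumes "rank_one_stable I f" "finite I"
    and "\<And>k. k \<in> set ks \<Longrightarrow> fst k \<in> I \<and> 0 \<le> \<alpha> k \<and> \<alpha> k \<le> 1"
    and "\<And>k. k \<in> set ks \<Longrightarrow> orthogonal_matrix (P k) \<and> (\<exists>u. P k = mat 1 - outer u u)"
  shows "rank_one_stable I (averages ks \<alpha> P f)"
  using assms(3,4)
proof (induction ks)
  case Nil
  have "averages [] \<alpha> P f = f" by (rule ext) simp
  then show ?case using assms(1) by simp
next
  case (Cons k ks)
  then have "rank_one_stable I (averages ks \<alpha> P f)" by simp
  moreover obtain u where "P k = mat 1 - outer u u" "orthogonal_matrix (P k)"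
    using Cons.prems(2)[of k] by auto
  ultimately have "rank_one_stable I (\<lambda>A. smult (\<alpha> k) (averages ks \<alpha> P f (A(fst k := P k ** A (fst k) ** transpose (P k)))) +
      smult (1 - \<alpha> k) (averages ks \<alpha> P f A))"
    using Cons.prems(1)[of k] assms(2) by (intro rank_one_stable_average) auto
  then show ?case by simp
qed

text \<open>Unfolding the recursion gives one term for each set \<open>B\<close> of positions at
  which the swap is chosen. Its weight is the product of the individual probabilities.\<close>

lemma poly_averages:
  assumes "distinct ks"
  shows "poly (averages ks \<alpha> P f A) t =
    (\<Sum>B\<in>Pow (set ks). (\<Prod>k\<in>set ks. if k \<in> B then \<alpha> k else 1 - \<alpha> k) *
      poly (f (conjugations ks (\<lambda>k. if k \<in> B then P k else mat 1) A)) t)"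
  using assms
proof (induction ks arbitrary: A)
  case Nil
  show ?case by simp
next
  case (Cons k ks)
  let ?w = "\<lambda>ks B. \<Prod>k\<in>set ks. if k \<in> B then \<alpha> k else 1 - \<alpha> k"
  let ?X = "\<lambda>B k. if k \<in> B then P k else mat 1"
  let ?F = "\<lambda>B. ?w (k # ks) B * poly (f (conjugations (k # ks) (?X B) A)) t"
  have k: "k \<notin> set ks" using Cons.prems by simp
  \<comment> \<open>The subsets are split according to whether they contain \<open>k\<close>,
    matching the two branches of the recursion.\<close>
  have "sum ?F (Pow (set (k # ks))) = sum ?F (Pow (set ks)) + sum ?F (insert k ` Pow (set ks))"
    unfolding list.set(2) Pow_insert using k by (intro sum.union_disjoint) auto
  also have "sum ?F (insert k ` Pow (set ks)) = (\<Sum>B\<in>Pow (set ks). ?F (insert k B))"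
    using k by (intro sum.reindex_cong[of "insert k"]) (auto simp: inj_on_def)
  also have "\<dots> = \<alpha> k * poly (averages ks \<alpha> P f (A(fst k := P k ** A (fst k) ** transpose (P k)))) t"
  proof -
    \<comment> \<open>By distinctness \<open>k\<close> does not recur in the tail, so adding it to
      \<open>B\<close> changes nothing there.\<close>
    have "?w ks (insert k B) = ?w ks B" for B
      using k by (intro prod.cong) auto
    moreover have "conjugations ks (?X (insert k B)) A' = conjugations ks (?X B) A'" for B A'
      using k by (intro conjugations_cong) auto
    ultimately show ?thesis
      using Cons k by (simp add: sum_distrib_left mult.assoc)
  qed
  also have "sum ?F (Pow (set ks)) = (1 - \<alpha> k) * poly (averages ks \<alpha> P f A) t"
  proof -
    have "?F B = (1 - \<alpha> k) * (?w ks B * poly (f (conjugations ks (?X B) A)) t)" if "B \<in> Pow (set ks)" for B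
    proof -
      have "k \<notin> B" using that k by auto
      then show ?thesis using k by (simp add: mult.assoc)
    qed
    then have "sum ?F (Pow (set ks)) =
        (\<Sum>B\<in>Pow (set ks). (1 - \<alpha> k) * (?w ks B * poly (f (conjugations ks (?X B) A)) t))"
      by (intro sum.cong refl)
    then show ?thesis
      using Cons by (simp add: sum_distrib_left)
  qed
  finally show ?case by (simp add: fun_upd_def)
qed

section \<open>Measurability of matrix operations, by continuity\<close>

lemma borel_measurable_det:
  fixes X :: "'w \<Rightarrow> real ^ 'n ^ 'n"
  assumes "X \<in> borel_measurable M"
  shows "(\<lambda>\<omega>. det (X \<omega>)) \<in> borel_measurable M"
proof -
  have "continuous_on UNIV (det :: real ^ 'n ^ 'n \<Rightarrow> real)"
    unfolding det_def by (intro continuous_intros)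
  then show ?thesis
    using assms by (rule borel_measurable_continuous_on)
qed

lemma borel_measurable_matrix_mult:
  fixes X Y :: "'w \<Rightarrow> real ^ 'n ^ 'n"
  assumes "X \<in> borel_measurable M" "Y \<in> borel_measurable M"
  shows "(\<lambda>\<omega>. X \<omega> ** Y \<omega>) \<in> borel_measurable M"
proof -
  have "continuous_on UNIV (\<lambda>p :: (real ^ 'n ^ 'n) \<times> (real ^ 'n ^ 'n). fst p ** snd p)"
    unfolding matrix_matrix_mult_def by (intro continuous_intros)
  then show ?thesis
    by (rule borel_measurable_continuous_Pair[OF assms, where H = "(**)"])
qed

lemma borel_measurable_transpose:
  fixes X :: "'w \<Rightarrow> real ^ 'n ^ 'n"
  assumes "X \<in> borel_measurable M"
  shows "(\<lambda>\<omega>. transpose (X \<omega>)) \<in> borel_measurable M"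
proof -
  have "continuous_on UNIV (transpose :: real ^ 'n ^ 'n \<Rightarrow> _)"
    unfolding transpose_def by (intro continuous_intros)
  then show ?thesis
    using assms by (rule borel_measurable_continuous_on)
qed

lemma borel_measurable_mat_prod_list:
  fixes X :: "'k \<Rightarrow> 'w \<Rightarrow> real ^ 'n ^ 'n"
  assumes "\<And>k. k \<in> set ks \<Longrightarrow> X k \<in> borel_measurable M"
  shows "(\<lambda>\<omega>. mat_prod_list (map (\<lambda>k. X k \<omega>) ks)) \<in> borel_measurable M"
  using assms by (induction ks) (auto intro: borel_measurable_matrix_mult)

section \<open>Expectation over independent two-valued variables\<close>

context prob_space
begin

text \<open>Almost surely each variable takes one of its two values, so the integrand is almost
  everywhere a finite sum over the joint outcomes. Independence gives each outcome a product
  probability.\<close>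

lemma expectation_two_valued:
  fixes S :: "'k \<Rightarrow> 'a \<Rightarrow> real ^ 'n ^ 'n" and G :: "('k \<Rightarrow> real ^ 'n ^ 'n) \<Rightarrow> real"
  assumes fin: "finite K" and ind: "indep_vars (\<lambda>_. borel) S K"
    and S: "\<And>k. k \<in> K \<Longrightarrow> S k \<in> borel_measurable M"
    and ne: "\<And>k. k \<in> K \<Longrightarrow> P k \<noteq> Q k"
    and P: "\<And>k. k \<in> K \<Longrightarrow> prob {\<omega> \<in> space M. S k \<omega> = P k} = \<alpha> k"
    and Q: "\<And>k. k \<in> K \<Longrightarrow> prob {\<omega> \<in> space M. S k \<omega> = Q k} = 1 - \<alpha> k"
    and G: "\<And>X Y. (\<And>k. k \<in> K \<Longrightarrow> X k = Y k) \<Longrightarrow> G X = G Y"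
    and meas: "(\<lambda>\<omega>. G (\<lambda>k. S k \<omega>)) \<in> borel_measurable M"
  shows "expectation (\<lambda>\<omega>. G (\<lambda>k. S k \<omega>)) =
    (\<Sum>B\<in>Pow K. (\<Prod>k\<in>K. if k \<in> B then \<alpha> k else 1 - \<alpha> k) * G (\<lambda>k. if k \<in> B then P k else Q k))"
proof -
  define X where "X = (\<lambda>B k. if k \<in> B then P k else Q k)"
  \<comment> \<open>The event of the joint outcome in which exactly the indices in \<open>B\<close>
    take the value \<open>P k\<close>, for \<open>B\<close> a subset of \<open>K\<close>.\<close>
  define E where "E = (\<lambda>B. {\<omega> \<in> space M. \<forall>k\<in>K. S k \<omega> = X B k})"
  have ev: "{\<omega> \<in> space M. S k \<omega> = Y} \<in> events" if "k \<in> K" for k Y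
    using measurable_sets[OF S[OF that], of "{Y}"] by (simp add: vimage_def Int_def conj_commute)
  have E_ev: "E B \<in> events" for B
    unfolding E_def using fin ev by (intro sets.sets_Collect_finite_All) auto
  have prob_E: "prob (E B) = (\<Prod>k\<in>K. if k \<in> B then \<alpha> k else 1 - \<alpha> k)" for B
  \<comment> \<open>The product rule for independent variables is stated for a nonempty index set;
    for empty \<open>K\<close> the event is the whole space.\<close>
  proof (cases "K = {}")
    case True
    then show ?thesis by (simp add: E_def prob_space)
  next
    case False
    have "E B = (\<Inter>k\<in>K. S k -` {X B k} \<inter> space M)"
      using False by (auto simp: E_def)
    then have "prob (E B) = (\<Prod>k\<in>K. prob (S k -` {X B k} \<inter> space M))"
      using indep_varsD_finite[OF ind False fin, of "\<lambda>k. {X B k}"] False by simp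
    also have "\<dots> = (\<Prod>k\<in>K. if k \<in> B then \<alpha> k else 1 - \<alpha> k)"
    proof (intro prod.cong refl)
      fix k assume "k \<in> K"
      moreover have "S k -` {X B k} \<inter> space M = {\<omega> \<in> space M. S k \<omega> = X B k}" by auto
      ultimately show "prob (S k -` {X B k} \<inter> space M) = (if k \<in> B then \<alpha> k else 1 - \<alpha> k)"
        by (simp add: X_def P Q)
    qed
    finally show ?thesis .
  qed
  have ae: "AE \<omega> in M. S k \<omega> = P k \<or> S k \<omega> = Q k" if k: "k \<in> K" for k
  proof -
    have "prob ({\<omega> \<in> space M. S k \<omega> = P k} \<union> {\<omega> \<in> space M. S k \<omega> = Q k}) = 1"
      using ne[OF k] P[OF k] Q[OF k] by (subst finite_measure_Union) (auto intro: ev k)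
    then have "AE \<omega> in M. \<omega> \<in> {\<omega> \<in> space M. S k \<omega> = P k} \<union> {\<omega> \<in> space M. S k \<omega> = Q k}"
      by (rule AE_prob_1)
    then show ?thesis by eventually_elim auto
  qed
  have "AE \<omega> in M. \<forall>k\<in>K. S k \<omega> = P k \<or> S k \<omega> = Q k"
    using fin ae by (rule AE_finite_allI)
  then have "AE \<omega> in M. G (\<lambda>k. S k \<omega>) = (\<Sum>B\<in>Pow K. G (X B) * indicator (E B) \<omega>)"
    using AE_space
  proof eventually_elim
    case (elim \<omega>)
    \<comment> \<open>This reads the outcome off the sample point: \<open>E B\<close> is the only
      one of these events that contains it.\<close>
    define B where "B = {k \<in> K. S k \<omega> = P k}"
    have in_E: "\<omega> \<in> E C \<longleftrightarrow> C = B" if "C \<in> Pow K" for C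
      using that elim ne by (fastforce simp: E_def B_def X_def split: if_splits)
    have "(\<Sum>C\<in>Pow K. G (X C) * indicator (E C) \<omega>) = (\<Sum>C\<in>Pow K. if C = B then G (X C) else 0)"
      by (intro sum.cong refl) (simp add: in_E)
    also have "\<dots> = G (X B)"
      using fin by (simp add: B_def)
    also have "\<dots> = G (\<lambda>k. S k \<omega>)"
      using in_E[of B] by (intro G) (auto simp: E_def B_def)
    finally show ?case by simp
  qed
  then have "expectation (\<lambda>\<omega>. G (\<lambda>k. S k \<omega>)) = expectation (\<lambda>\<omega>. \<Sum>B\<in>Pow K. G (X B) * indicator (E B) \<omega>)"
    using meas E_ev by (intro integral_cong_AE) simp_all
  also have "\<dots> = (\<Sum>B\<in>Pow K. G (X B) * prob (E B))"
    using E_ev by (subst Bochner_Integration.integral_sum) (simp_all add: emeasure_eq_measure)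
  finally show ?thesis
    by (simp add: prob_E X_def mult.commute)
qed

end

theorem theorem3p3:
  fixes M :: "'w measure"
    and A :: "nat \<Rightarrow> real ^ 'n ^ 'n"
    and S :: "nat \<Rightarrow> nat \<Rightarrow> 'w \<Rightarrow> real ^ 'n ^ 'n"
    and m N :: nat
  assumes "prob_space M"
    and "\<And>i. i \<in> {1..m} \<Longrightarrow> transpose (A i) = A i"
    and "\<And>i j. i \<in> {1..m} \<Longrightarrow> j \<in> {1..N} \<Longrightarrow> prob_space.random_swap M (S i j)"
    and "prob_space.indep_vars M (\<lambda>_. borel) (\<lambda>(i, j). S i j) ({1..m} \<times> {1..N})"
  shows "\<exists>p :: real poly.
      (\<forall>t. poly p t = (LINT \<omega>|M. det (mat t -
          (\<Sum>i = 1..m. mat_prod_list (map (\<lambda>j. S i j \<omega>) (rev [1..<Suc N])) ** A i **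
                         mat_prod_list (map (\<lambda>j. transpose (S i j \<omega>)) [1..<Suc N]))))) \<and>
      real_rooted p"
proof -
  interpret prob_space M by fact
  let ?K = "{1..m} \<times> {1..N}"
  \<comment> \<open>Listing the pairs row by row makes those with first component \<open>i\<close>
    appear with \<open>j\<close> increasing from \<open>1\<close> to \<open>N\<close>, the order in
    which the swaps act on \<open>A i\<close>.\<close>
  define ks where "ks = List.product [1..<Suc m] [1..<Suc N]"
  have ks: "set ks = ?K" "distinct ks"
    by (auto simp: ks_def distinct_product)
  have filter_ks: "filter (\<lambda>k. fst k = i) ks = map (Pair i) [1..<Suc N]" if "i \<in> {1..m}" for i
    using that by (simp add: ks_def filter_fst_product del: upt_Suc)
  \<comment> \<open>Collecting all properties in one predicate allows \<open>P k\<close> and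
    \<open>\<alpha> k\<close> to be chosen together for every index pair.\<close>
  define swap where "swap = (\<lambda>k P \<alpha>. orthogonal_matrix P \<and> (\<exists>u. P = mat 1 - outer u u) \<and> P \<noteq> mat 1 \<and>
      0 \<le> \<alpha> \<and> \<alpha> \<le> 1 \<and> prob {\<omega> \<in> space M. S (fst k) (snd k) \<omega> = P} = \<alpha> \<and>
      prob {\<omega> \<in> space M. S (fst k) (snd k) \<omega> = mat 1} = 1 - \<alpha>)"
  have "\<exists>P \<alpha>. swap k P \<alpha>" if "k \<in> ?K" for k
  proof -
    have "random_swap (S (fst k) (snd k))"
      using assms(3) that by auto
    then show ?thesis
      unfolding random_swap_def swap_def using permutation_matrix_transpose by meson
  qed
  then obtain P \<alpha> where "\<And>k. k \<in> ?K \<Longrightarrow> swap k (P k) (\<alpha> k)"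
    by metis
  then have P: "\<And>k. k \<in> ?K \<Longrightarrow> orthogonal_matrix (P k) \<and> (\<exists>u. P k = mat 1 - outer u u)"
      "\<And>k. k \<in> ?K \<Longrightarrow> P k \<noteq> mat 1"
    and \<alpha>: "\<And>k. k \<in> ?K \<Longrightarrow> 0 \<le> \<alpha> k \<and> \<alpha> k \<le> 1"
    and prob: "\<And>k. k \<in> ?K \<Longrightarrow> prob {\<omega> \<in> space M. S (fst k) (snd k) \<omega> = P k} = \<alpha> k"
      "\<And>k. k \<in> ?K \<Longrightarrow> prob {\<omega> \<in> space M. S (fst k) (snd k) \<omega> = mat 1} = 1 - \<alpha> k"
    unfolding swap_def by blast+
  have S: "S i j \<in> borel_measurable M" if "i \<in> {1..m}" "j \<in> {1..N}" for i j
    using assms(3)[OF that] by (simp add: random_swap_def)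
  define f where "f = (\<lambda>A :: nat \<Rightarrow> real ^ 'n ^ 'n. charpoly (\<Sum>i = 1..m. A i))"
  \<comment> \<open>The witness is the iterated average of the characteristic polynomial of the sum,
    taken at the given matrices.\<close>
  define p where "p = averages ks \<alpha> P f A"
  define F where "F = (\<lambda>t \<omega>. det (mat t -
      (\<Sum>i = 1..m. mat_prod_list (map (\<lambda>j. S i j \<omega>) (rev [1..<Suc N])) ** A i **
                     mat_prod_list (map (\<lambda>j. transpose (S i j \<omega>)) [1..<Suc N]))))"
  have conj_eq: "conjugations ks (\<lambda>k. S (fst k) (snd k) \<omega>) A i =
      mat_prod_list (map (\<lambda>j. S i j \<omega>) (rev [1..<Suc N])) ** A i **
      mat_prod_list (map (\<lambda>j. transpose (S i j \<omega>)) [1..<Suc N])" if "i \<in> {1..m}" for i \<omega>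
    by (simp add: conjugations_eq filter_ks[OF that] o_def rev_map del: upt_Suc)
  have F_eq: "poly (f (conjugations ks (\<lambda>k. S (fst k) (snd k) \<omega>) A)) t = F t \<omega>" for t \<omega>
    by (simp only: f_def F_def poly_charpoly conj_eq cong: sum.cong)
  have F_meas: "F t \<in> borel_measurable M" for t
    unfolding F_def
    by (intro borel_measurable_det borel_measurable_diff borel_measurable_sum borel_measurable_const
        borel_measurable_matrix_mult borel_measurable_mat_prod_list borel_measurable_transpose S) auto
  have "poly p t = (LINT \<omega>|M. F t \<omega>)" for t
  proof -
    \<comment> \<open>Both sides expand into the same sum over subsets of index pairs, one by
      independence and the other by \<open>poly_averages\<close>.\<close>
    have "expectation (\<lambda>\<omega>. poly (f (conjugations ks (\<lambda>k. S (fst k) (snd k) \<omega>) A)) t) = poly p t"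
      unfolding p_def poly_averages[OF ks(2)] ks(1)
      using assms(4)[unfolded case_prod_unfold] P(2) prob F_meas S
      by (intro expectation_two_valued arg_cong[of _ _ "\<lambda>A. poly (f A) t"] conjugations_cong)
        (auto simp: F_eq ks(1))
    then show ?thesis by (simp only: F_eq)
  qed
  moreover have "real_rooted p"
  proof (rule real_rootedI)
    fix z :: complex assume z: "Im z > 0"
    have "rank_one_stable {1..m} f"
      unfolding f_def by (rule rank_one_stable_charpoly) simp
    then have st: "rank_one_stable {1..m} (averages ks \<alpha> P f)"
    proof (rule rank_one_stable_averages)
      show "fst k \<in> {1..m} \<and> 0 \<le> \<alpha> k \<and> \<alpha> k \<le> 1" if "k \<in> set ks" for k
        using that \<alpha>[of k] by (auto simp: ks(1))
      show "orthogonal_matrix (P k) \<and> (\<exists>u. P k = mat 1 - outer u u)" if "k \<in> set ks" for k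
        using that P(1)[of k] by (simp add: ks(1))
    qed simp
    have "symmetric_on {1..m} A"
      using assms(2) by (simp add: symmetric_on_def)
    from rank_one_stable_nonzero[OF st this z] show "ceval p z \<noteq> 0"
      unfolding p_def .
  qed
  ultimately show ?thesis
    unfolding F_def by blast
qed

end
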